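(* For every global type $G$ and queue $\mathcal M$, if $\emptyset\vdash_{\mathrm{ib}}G\parallel\mathcal M$ (inductive balancing with empty set of hypotheses), then $G\parallel\mathcal M$ is balanced.
   Context: Participants $\mathsf p,\mathsf q,\mathsf r,\mathsf s$; labels $\lambda$. A message is $\langle\mathsf p,\lambda,\mathsf q\rangle$; a queue $\mathcal M$ is a finite sequence of messages ($\emptyset$, $\cdot$), modulo the congruence $\equiv$ generated by $\langle\mathsf p,\lambda,\mathsf q\rangle\cdot\langle\mathsf r,\lambda',\mathsf s\rangle\equiv\langle\mathsf r,\lambda',\mathsf s\rangle\cdot\langle\mathsf p,\lambda,\mathsf q\rangle$ when $\mathsf p\neq\mathsf r$ or $\mathsf q\neq\mathsf s$. Global types are possibly infinite regular terms $G ::= \mathsf{End}\mid \mathsf p\mathsf q!\{\lambda_i;G_i\}_{i\in I}\mid\mathsf p\mathsf q?\{\lambda_i;G_i\}_{i\in I}$ ($I$ finite nonempty, $\mathsf p\neq\mathsf q$, $\lambda_i$ distinct); $\mathsf p\mathsf q\dagger$ denotes either form. Readability $\mathrm{read}(G,\mathcal M)$ (inductive): $\mathrm{read}(G,\emptyset)$; $\mathrm{read}(\mathsf p\mathsf q!\{\lambda_i;G_i\}_{i\in I},\mathcal M)$ if $\mathrm{read}(G_i,\mathcal M)$ $\forall i$; $\mathrm{read}(\mathsf p\mathsf q?\{\lambda_i;G_i\}_{i\in I},\langle\mathsf p,\lambda_h,\mathsf q\rangle\cdot\mathcal M)$ if $h\in I$ and $\mathrm{read}(G_i,\mathcal M)$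 $\forall i$; $\mathrm{read}(\mathsf p\mathsf q?\{\lambda_i;G_i\}_{i\in I},\mathcal M)$ if $\mathcal M\not\equiv\langle\mathsf p,\lambda_i,\mathsf q\rangle\cdot\mathcal M'$ for all $i\in I$, $\mathcal M'$, and $\mathrm{read}(G_i,\mathcal M)$ $\forall i$. Balancing (coinductive): $\mathsf{End}\parallel\emptyset$ is balanced; $G=\mathsf p\mathsf q!\{\lambda_i;G_i\}_{i\in I}$ with $\mathcal M$ is balanced if $\mathrm{read}(G,\mathcal M)$ and each $G_i\parallel\mathcal M\cdot\langle\mathsf p,\lambda_i,\mathsf q\rangle$ is balanced; $G=\mathsf p\mathsf q?\{\lambda_i;G_i\}_{i\in I}$ with $\langle\mathsf p,\lambda_h,\mathsf q\rangle\cdot\mathcal M$, $h\in I$, is balanced if $\mathrm{read}(G,\langle\mathsf p,\lambda_h,\mathsf q\rangle\cdot\mathcal M)$ and $G_h\parallel\mathcal M$ is balanced. $G$-equivalence: $\langle\mathsf p,\lambda,\mathsf q\rangle,\langle\mathsf p,\lambda',\mathsf q\rangle$ are $G$-indistinguishable if $\lambda,\lambda'$ occur in $G$ and for every input choice $\mathsf p\mathsf q?\{\lambda_i;G_i\}_{i\in I}$ occurring in $G$, either $\{\lambda,\lambda'\}\cap\{\lambda_i\}_{i\in I}=\emptyset$ or $\lambda=\lambda_h,\lambda'=\lambda_k,G_h=G_k$ for some $h,k\in I$; $\equiv_G$ extends $\equiv$ with $\mathcal M_1\cdot\langle\mathsf p,\lambda,\mathsf q\rangle\cdot\mathcal M_2\equiv_G\mathcal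 M_1\cdot\langle\mathsf p,\lambda',\mathsf q\rangle\cdot\mathcal M_2$ for $G$-indistinguishable messages. Agreement $\mathcal H\vdash_{\mathrm{agr}}G:\mathcal M$ ($\mathcal H$ a finite set of pairs (global type, queue)), inductive: $\mathcal H\vdash_{\mathrm{agr}}\mathsf{End}:\mathcal M$; $\mathcal H\cup\{(G,\mathcal M)\}\vdash_{\mathrm{agr}}G:\mathcal M$; for $G=\mathsf p\mathsf q!\{\lambda_i;G_i\}_{i\in I}$, $\mathcal H\vdash_{\mathrm{agr}}G:\mathcal M$ if for each $i\in I$ there is $\mathcal M_i$ with $\mathcal M\cdot\langle\mathsf p,\lambda_i,\mathsf q\rangle\equiv_{G_i}\langle\mathsf p,\lambda_i,\mathsf q\rangle\cdot\mathcal M_i$ and $\mathcal H\cup\{(G,\mathcal M)\}\vdash_{\mathrm{agr}}G_i:\mathcal M_i$; for $G=\mathsf p\mathsf q?\{\lambda_i;G_i\}_{i\in I}$, $\mathcal H\vdash_{\mathrm{agr}}G:\mathcal M$ if $\mathcal H\cup\{(G,\mathcal M)\}\vdash_{\mathrm{agr}}G_i:\mathcal M$ for all $i\in I$. Deep readability $\mathcal S\vdash_{\mathrm{dread}}G:\mathcal M$ ($\mathcal S$ a finite set of global types), inductive: $\mathcal S\vdash_{\mathrm{dread}}\mathsf{End}:\emptyset$; $\mathcal S\cup\{G\}\vdash_{\mathrm{dread}}G:\mathcal M$ if $\mathrm{read}(G,\mathcal M)$; for $G=\mathsf p\mathsf q\dagger\{\lambda_i;G_i\}_{i\in I}$, $\mathcal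 S\vdash_{\mathrm{dread}}G:\mathcal M$ if $\mathcal S\cup\{G\}\vdash_{\mathrm{dread}}G_i:\mathcal M$ for all $i\in I$. $\mathrm{ok}(G,\mathcal M,\mathcal M')$ holds if there is $\mathcal M''$ with $\mathcal M'\equiv\mathcal M\cdot\mathcal M''$, $\emptyset\vdash_{\mathrm{agr}}G:\mathcal M''$, $\emptyset\vdash_{\mathrm{dread}}G:\mathcal M''$ and $\mathrm{read}(G,\mathcal M)$. Inductive balancing $\mathcal H\vdash_{\mathrm{ib}}G\parallel\mathcal M$ ($\mathcal H$ a finite set of pairs (global type, queue)), inductive: $\mathcal H\vdash_{\mathrm{ib}}\mathsf{End}\parallel\emptyset$; $\mathcal H\cup\{(G,\mathcal M)\}\vdash_{\mathrm{ib}}G\parallel\mathcal M'$ if $\mathrm{ok}(G,\mathcal M,\mathcal M')$; for $G=\mathsf p\mathsf q!\{\lambda_i;G_i\}_{i\in I}$, $\mathcal H\vdash_{\mathrm{ib}}G\parallel\mathcal M$ if $\mathrm{read}(G,\mathcal M)$ and $\mathcal H\cup\{(G,\mathcal M)\}\vdash_{\mathrm{ib}}G_i\parallel\mathcal M\cdot\langle\mathsf p,\lambda_i,\mathsf q\rangle$ for all $i\in I$; for $G=\mathsf p\mathsf q?\{\lambda_i;G_i\}_{i\in I}$ and $h\in I$, $\mathcal H\vdash_{\mathrm{ib}}G\parallel\langle\mathsf p,\lambda_h,\mathsf q\rangle\cdot\mathcal M$ if $\mathrm{read}(G,\langle\mathsf p,\lambda_h,\mathsf q\rangle\cdot\mathcal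 M)$ and $\mathcal H\cup\{(G,\langle\mathsf p,\lambda_h,\mathsf q\rangle\cdot\mathcal M)\}\vdash_{\mathrm{ib}}G_h\parallel\mathcal M$. *)

theory Defs
  imports "HOL-Library.Finite_Map"
begin

section \<open>Queues\<close>

datatype ('p, 'l) msg = Msg (sender: 'p) (label: 'l) (receiver: 'p)

inductive msgs_cong :: "('p, 'l) msg list \<Rightarrow> ('p, 'l) msg list \<Rightarrow> bool" where
  refl: "msgs_cong ms ms"
| sym: "msgs_cong ms ms' \<Longrightarrow> msgs_cong ms' ms"
| trans: "msgs_cong ms ms' \<Longrightarrow> msgs_cong ms' ms'' \<Longrightarrow> msgs_cong ms ms''"
| swap: "p \<noteq> r \<or> q \<noteq> s \<Longrightarrow>
    msgs_cong (ms @ [Msg p l q, Msg r l' s] @ ms') (ms @ [Msg r l' s, Msg p l q] @ ms')"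

lemma equivp_msgs_cong: "equivp msgs_cong"
  by (intro equivpI reflpI sympI transpI) (blast intro: msgs_cong.intros)+

lemma msgs_cong_append_left: "msgs_cong ms ms' \<Longrightarrow> msgs_cong (ns @ ms) (ns @ ms')"
proof (induction rule: msgs_cong.induct)
  case (swap p r q s ms l l' ms')
  then show ?case using msgs_cong.swap[of p r q s "ns @ ms" l l' ms'] by simp
qed (blast intro: msgs_cong.intros)+

lemma msgs_cong_append_right: "msgs_cong ms ms' \<Longrightarrow> msgs_cong (ms @ ns) (ms' @ ns)"
proof (induction rule: msgs_cong.induct)
  case (swap p r q s ms l l' ms')
  then show ?case using msgs_cong.swap[of p r q s ms l l' "ms' @ ns"] by simp
qed (blast intro: msgs_cong.intros)+

text \<open>Queues are taken modulo the congruence, so from here on equality of queues is the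
  congruence of the underlying message sequences.\<close>

quotient_type ('p, 'l) queue = "('p, 'l) msg list" / msgs_cong
  by (rule equivp_msgs_cong)

lift_definition qempty :: "('p, 'l) queue" (\<open>\<emptyset>\<close>) is "[]" .

lift_definition qmsg :: "'p \<Rightarrow> 'l \<Rightarrow> 'p \<Rightarrow> ('p, 'l) queue" (\<open>\<langle>_,/ _,/ _\<rangle>\<close>)
  is "\<lambda>p l q. [Msg p l q]" .

lift_definition qappend :: "('p, 'l) queue \<Rightarrow> ('p, 'l) queue \<Rightarrow> ('p, 'l) queue"  (infixr \<open>\<cdot>\<close> 75)
  is "(@)"
  by (blast intro: msgs_cong.trans msgs_cong_append_left msgs_cong_append_right)


section \<open>Global types\<close>

text \<open>A family of branches indexed by pairwise distinct labels is a finite map from labels.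
  Being a codatatype, the type below contains all, possibly infinite, trees; regularity,
  nonempty choices and distinct participants are imposed by the predicate \<open>global_type\<close>.\<close>

codatatype ('p, 'l) gtype =
    End
  | Out 'p 'p "('l, ('p, 'l) gtype) fmap"
  | Inp 'p 'p "('l, ('p, 'l) gtype) fmap"

inductive subterm :: "('p, 'l) gtype \<Rightarrow> ('p, 'l) gtype \<Rightarrow> bool" where
  refl: "subterm G G"
| Out: "fmlookup B l = Some G' \<Longrightarrow> subterm G G' \<Longrightarrow> subterm G (Out p q B)"
| Inp: "fmlookup B l = Some G' \<Longrightarrow> subterm G G' \<Longrightarrow> subterm G (Inp p q B)"

definition global_type :: "('p, 'l) gtype \<Rightarrow> bool" where
  "global_type G \<longleftrightarrow>
     finite {G'. subterm G' G} \<and>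
     (\<forall>p q B. subterm (Out p q B) G \<or> subterm (Inp p q B) G \<longrightarrow> p \<noteq> q \<and> B \<noteq> fmempty)"

definition occurs_label :: "'l \<Rightarrow> ('p, 'l) gtype \<Rightarrow> bool" where
  "occurs_label l G \<longleftrightarrow>
     (\<exists>p q B. (subterm (Out p q B) G \<or> subterm (Inp p q B) G) \<and> l |\<in>| fmdom B)"


section \<open>Readability and balancing\<close>

inductive read :: "('p, 'l) gtype \<Rightarrow> ('p, 'l) queue \<Rightarrow> bool" where
  empty: "read G \<emptyset>"
| Out: "(\<forall>l G. fmlookup B l = Some G \<longrightarrow> read G M) \<Longrightarrow> read (Out p q B) M"
| Inp: "h |\<in>| fmdom B \<Longrightarrow> (\<forall>l G. fmlookup B l = Some G \<longrightarrow> read G M) \<Longrightarrow>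
    read (Inp p q B) (\<langle>p, h, q\<rangle> \<cdot> M)"
| Inp_skip: "(\<forall>l M'. l |\<in>| fmdom B \<longrightarrow> M \<noteq> \<langle>p, l, q\<rangle> \<cdot> M') \<Longrightarrow>
    (\<forall>l G. fmlookup B l = Some G \<longrightarrow> read G M) \<Longrightarrow> read (Inp p q B) M"

coinductive balanced :: "('p, 'l) gtype \<Rightarrow> ('p, 'l) queue \<Rightarrow> bool" where
  End: "balanced End \<emptyset>"
| Out: "read (Out p q B) M \<Longrightarrow>
    (\<forall>l G. fmlookup B l = Some G \<longrightarrow> balanced G (M \<cdot> \<langle>p, l, q\<rangle>)) \<Longrightarrow>
    balanced (Out p q B) M"
| Inp: "fmlookup B h = Some G \<Longrightarrow> read (Inp p q B) (\<langle>p, h, q\<rangle> \<cdot> M) \<Longrightarrow> balanced G M \<Longrightarrow>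
    balanced (Inp p q B) (\<langle>p, h, q\<rangle> \<cdot> M)"


section \<open>Agreement and deep readability\<close>

definition indistinguishable ::
    "('p, 'l) gtype \<Rightarrow> 'p \<Rightarrow> 'p \<Rightarrow> 'l \<Rightarrow> 'l \<Rightarrow> bool" where
  "indistinguishable G p q l l' \<longleftrightarrow>
     occurs_label l G \<and> occurs_label l' G \<and>
     (\<forall>B. subterm (Inp p q B) G \<longrightarrow>
        {l, l'} \<inter> fset (fmdom B) = {} \<or>
        (\<exists>G'. fmlookup B l = Some G' \<and> fmlookup B l' = Some G'))"

inductive gequiv :: "('p, 'l) gtype \<Rightarrow> ('p, 'l) queue \<Rightarrow> ('p, 'l) queue \<Rightarrow> bool"
  for G where
  refl: "gequiv G M M"
| sym: "gequiv G M M' \<Longrightarrow> gequiv G M' M"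
| trans: "gequiv G M M' \<Longrightarrow> gequiv G M' M'' \<Longrightarrow> gequiv G M M''"
| relabel: "indistinguishable G p q l l' \<Longrightarrow>
    gequiv G (M\<^sub>1 \<cdot> \<langle>p, l, q\<rangle> \<cdot> M\<^sub>2) (M\<^sub>1 \<cdot> \<langle>p, l', q\<rangle> \<cdot> M\<^sub>2)"

inductive agr ::
    "(('p, 'l) gtype \<times> ('p, 'l) queue) fset \<Rightarrow> ('p, 'l) gtype \<Rightarrow> ('p, 'l) queue \<Rightarrow> bool" where
  End: "agr H End M"
| cycle: "agr (finsert (G, M) H) G M"
| Out: "(\<forall>l G. fmlookup B l = Some G \<longrightarrow>
      (\<exists>M'. gequiv G (M \<cdot> \<langle>p, l, q\<rangle>) (\<langle>p, l, q\<rangle> \<cdot> M') \<and>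
            agr (finsert (Out p q B, M) H) G M')) \<Longrightarrow>
    agr H (Out p q B) M"
| Inp: "(\<forall>l G. fmlookup B l = Some G \<longrightarrow> agr (finsert (Inp p q B, M) H) G M) \<Longrightarrow>
    agr H (Inp p q B) M"

inductive dread :: "('p, 'l) gtype fset \<Rightarrow> ('p, 'l) gtype \<Rightarrow> ('p, 'l) queue \<Rightarrow> bool" where
  End: "dread S End \<emptyset>"
| cycle: "read G M \<Longrightarrow> dread (finsert G S) G M"
| Out: "(\<forall>l G. fmlookup B l = Some G \<longrightarrow> dread (finsert (Out p q B) S) G M) \<Longrightarrow>
    dread S (Out p q B) M"
| Inp: "(\<forall>l G. fmlookup B l = Some G \<longrightarrow> dread (finsert (Inp p q B) S) G M) \<Longrightarrow>
    dread S (Inp p q B) M"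

definition ok :: "('p, 'l) gtype \<Rightarrow> ('p, 'l) queue \<Rightarrow> ('p, 'l) queue \<Rightarrow> bool" where
  "ok G M M' \<longleftrightarrow>
     (\<exists>M''. M' = M \<cdot> M'' \<and> agr {||} G M'' \<and> dread {||} G M'' \<and> read G M)"


section \<open>Inductive balancing\<close>

inductive ibalanced ::
    "(('p, 'l) gtype \<times> ('p, 'l) queue) fset \<Rightarrow> ('p, 'l) gtype \<Rightarrow> ('p, 'l) queue \<Rightarrow> bool" where
  End: "ibalanced H End \<emptyset>"
| cycle: "ok G M M' \<Longrightarrow> ibalanced (finsert (G, M) H) G M'"
| Out: "read (Out p q B) M \<Longrightarrow>
    (\<forall>l G. fmlookup B l = Some G \<longrightarrow>
      ibalanced (finsert (Out p q B, M) H) G (M \<cdot> \<langle>p, l, q\<rangle>)) \<Longrightarrow>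
    ibalanced H (Out p q B) M"
| Inp: "fmlookup B h = Some G \<Longrightarrow> read (Inp p q B) (\<langle>p, h, q\<rangle> \<cdot> M) \<Longrightarrow>
    ibalanced (finsert (Inp p q B, \<langle>p, h, q\<rangle> \<cdot> M) H) G M \<Longrightarrow>
    ibalanced H (Inp p q B) (\<langle>p, h, q\<rangle> \<cdot> M)"

end

theory Submission
  imports Defs "HOL-Library.Sublist"
begin

text \<open>A finite derivation of inductive balancing is a graph with back edges: a leaf
  \<open>G \<parallel> M \<cdot> N\<close> points back to an inner node \<open>G \<parallel> M\<close>, where the surplus \<open>N\<close> is in agreement
  with \<open>G\<close> and deeply readable. From the leaf one replays the derivation of \<open>G \<parallel> M\<close> while carrying
  the surplus behind the queue: agreement lets every new output move in front of the surplus
  (up to indistinguishable labels), and deep readability keeps the whole queue readable and forces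
  the surplus to be empty at \<open>End\<close>. Surpluses from successive back edges are concatenated.

  A queue is determined by the label sequences of its channels. An output may rotate a channel of the
  surplus \<open>N\<close>; it stays deeply readable because the rotated sequence embeds into that of
  \<open>N \<cdot> N\<close>, and readability is downward closed under embedding.\<close>

section \<open>Queues as families of channels\<close>

text \<open>Well defined on queues because a swap never exchanges two messages of the same
  channel.\<close>

lift_definition channel :: "'p \<Rightarrow> 'p \<Rightarrow> ('p, 'l) queue \<Rightarrow> 'l list"
  is "\<lambda>p q ms. map label (filter (\<lambda>m. sender m = p \<and> receiver m = q) ms)"
  subgoal for p q ms ms'
    by (induction rule: msgs_cong.induct) auto
  done

lemma channel_empty [simp]: "channel p q \<emptyset> = []"
  by transfer simp

lemma channel_msg: "channel r s \<langle>p, l, q\<rangle> = (if r = p \<and> s = q then [l] else [])"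
  by transfer auto

lemma channel_append [simp]: "channel p q (M \<cdot> N) = channel p q M @ channel p q N"
  by transfer simp

text \<open>Every message in front of the first one on channel \<open>p\<close>, \<open>q\<close>
  belongs to another channel, so that one can be swapped to the front.\<close>

lemma msgs_cong_pull:
  assumes "map label (filter (\<lambda>m. sender m = p \<and> receiver m = q) ms) = l # ls"
  shows "\<exists>ms'. msgs_cong ms (Msg p l q # ms')"
  using assms
proof (induction ms)
  case (Cons m ms)
  show ?case
  proof (cases "sender m = p \<and> receiver m = q")
    case True
    then have "m = Msg p l q"
      using Cons.prems by (cases m) auto
    then show ?thesis
      by (blast intro: msgs_cong.refl)
  next
    case False
    with Cons obtain ms' where "msgs_cong ms (Msg p l q # ms')"
      by auto
    then have "msgs_cong (m # ms) (m # Msg p l q # ms')"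
      using msgs_cong_append_left[of _ _ "[m]"] by simp
    moreover have "msgs_cong (m # Msg p l q # ms') (Msg p l q # m # ms')"
      using False msgs_cong.swap[of "sender m" p "receiver m" q "[]" "label m" l ms']
      by (cases m) auto
    ultimately show ?thesis
      by (blast intro: msgs_cong.trans)
  qed
qed simp

lemma queue_head_ex: "channel p q M = l # ls \<Longrightarrow> \<exists>M'. M = \<langle>p, l, q\<rangle> \<cdot> M'"
  by transfer (simp add: msgs_cong_pull)

lemma queue_head:
  assumes "channel p q M = l # ls"
  obtains M' where "M = \<langle>p, l, q\<rangle> \<cdot> M'"
  using queue_head_ex[OF assms] by blast

lemma queue_eq_empty_iff: "M = \<emptyset> \<longleftrightarrow> (\<forall>p q. channel p q M = [])"
proof
  assume "\<forall>p q. channel p q M = []"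
  then show "M = \<emptyset>"
  proof transfer
    fix ms :: "('a, 'b) msg list"
    assume *: "\<forall>p q. map label (filter (\<lambda>m. sender m = p \<and> receiver m = q) ms) = []"
    have "ms = []"
    proof (cases ms)
      case (Cons m ms')
      then show ?thesis
        using *[rule_format, of "sender m" "receiver m"] by simp
    qed
    then show "msgs_cong ms []"
      by (simp add: msgs_cong.refl)
  qed
qed simp

lemma queue_empty_append [simp]: "\<emptyset> \<cdot> M = M"
  by transfer (simp add: msgs_cong.refl)

lemma queue_append_empty [simp]: "M \<cdot> \<emptyset> = M"
  by transfer (simp add: msgs_cong.refl)

lemma queue_append_assoc: "(M \<cdot> N) \<cdot> K = M \<cdot> N \<cdot> K"
  by transfer (simp add: msgs_cong.refl)


section \<open>Similar labels\<close>

text \<open>Indistinguishability without the requirement that the labels occur in the type; unlike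
  \<open>indistinguishable\<close> this is inherited by subterms. The two alternatives of the definition
  become a single equation, because \<open>fmlookup\<close> is \<open>None\<close> outside the domain.\<close>

definition label_sim :: "('p, 'l) gtype \<Rightarrow> 'p \<Rightarrow> 'p \<Rightarrow> 'l \<Rightarrow> 'l \<Rightarrow> bool" where
  "label_sim G p q l l' \<longleftrightarrow> (\<forall>B. subterm (Inp p q B) G \<longrightarrow> fmlookup B l = fmlookup B l')"

lemma label_sim_refl [simp]: "label_sim G p q l l"
  by (simp add: label_sim_def)

lemma label_sim_trans:
  "label_sim G p q l l' \<Longrightarrow> label_sim G p q l' l'' \<Longrightarrow> label_sim G p q l l''"
  by (simp add: label_sim_def)

lemma label_sim_Inp:
  "label_sim (Inp p q B) p q l l' \<Longrightarrow> fmlookup B l = fmlookup B l'"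
  by (auto simp: label_sim_def intro: subterm.refl)

lemma subterm_trans: "subterm G' G'' \<Longrightarrow> subterm G G' \<Longrightarrow> subterm G G''"
  by (induction rule: subterm.induct) (auto intro: subterm.intros)

lemma label_sim_subterm: "label_sim G p q l l' \<Longrightarrow> subterm G' G \<Longrightarrow> label_sim G' p q l l'"
  unfolding label_sim_def using subterm_trans by blast

lemma indistinguishable_imp_label_sim:
  assumes "indistinguishable G p q l l'"
  shows "label_sim G p q l l'"
  unfolding label_sim_def
proof (intro allI impI)
  fix B
  assume "subterm (Inp p q B) G"
  then consider "{l, l'} \<inter> fset (fmdom B) = {}"
    | G' where "fmlookup B l = Some G'" "fmlookup B l' = Some G'"
    using assms unfolding indistinguishable_def by blast
  then show "fmlookup B l = fmlookup B l'"
  proof cases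
    case 1
    then have "l |\<notin>| fmdom B" "l' |\<notin>| fmdom B"
      by simp_all
    then show ?thesis
      by (simp add: fmdom_notD)
  qed simp
qed

section \<open>Channelwise similarity and embedding of queues\<close>

definition queue_sim :: "('p, 'l) gtype \<Rightarrow> ('p, 'l) queue \<Rightarrow> ('p, 'l) queue \<Rightarrow> bool" where
  "queue_sim G M M' \<longleftrightarrow> (\<forall>p q. list_all2 (label_sim G p q) (channel p q M) (channel p q M'))"

definition queue_emb :: "('p, 'l) gtype \<Rightarrow> ('p, 'l) queue \<Rightarrow> ('p, 'l) queue \<Rightarrow> bool" where
  "queue_emb G M M' \<longleftrightarrow> (\<forall>p q. list_emb (label_sim G p q) (channel p q M) (channel p q M'))"

lemma queue_sim_refl [simp]: "queue_sim G M M"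
  by (simp add: queue_sim_def list_all2_refl)

lemma queue_sim_sym: "queue_sim G M M' \<Longrightarrow> queue_sim G M' M"
  by (simp add: queue_sim_def list_all2_conv_all_nth label_sim_def)

lemma queue_sim_trans: "queue_sim G M M' \<Longrightarrow> queue_sim G M' M'' \<Longrightarrow> queue_sim G M M''"
  by (simp add: queue_sim_def list_all2_conv_all_nth label_sim_def)

lemma queue_sim_append:
  "queue_sim G M M' \<Longrightarrow> queue_sim G N N' \<Longrightarrow> queue_sim G (M \<cdot> N) (M' \<cdot> N')"
  by (simp add: queue_sim_def list_all2_appendI)

lemma queue_sim_subterm: "queue_sim G M M' \<Longrightarrow> subterm G' G \<Longrightarrow> queue_sim G' M M'"
  unfolding queue_sim_def by (metis list_all2_mono label_sim_subterm)

lemma queue_sim_msg: "label_sim G p q l l' \<Longrightarrow> queue_sim G \<langle>p, l, q\<rangle> \<langle>p, l', q\<rangle>"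
  by (simp add: queue_sim_def channel_msg)

text \<open>This is all the proof uses of \<open>gequiv\<close>. Similarity passes to subterms,
  where the labels need no longer occur.\<close>

lemma gequiv_imp_queue_sim: "gequiv G M M' \<Longrightarrow> queue_sim G M M'"
proof (induction rule: gequiv.induct)
  case (relabel p q l l' M\<^sub>1 M\<^sub>2)
  then show ?case
    by (intro queue_sim_append queue_sim_refl queue_sim_msg indistinguishable_imp_label_sim)
next
  case (sym M M')
  from sym.IH show ?case
    by (rule queue_sim_sym)
next
  case (trans M M' M'')
  then show ?case
    by (metis queue_sim_trans)
qed simp

lemma queue_emb_subterm: "queue_emb G M M' \<Longrightarrow> subterm G' G \<Longrightarrow> queue_emb G' M M'"
  unfolding queue_emb_def by (metis list_emb_mono label_sim_subterm)

lemma queue_emb_branch: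
  assumes "fmlookup B l = Some G"
  shows "queue_emb (Out p q B) M M' \<Longrightarrow> queue_emb G M M'"
    and "queue_emb (Inp p q B) M M' \<Longrightarrow> queue_emb G M M'"
  by (erule queue_emb_subterm, blast intro: assms subterm.intros)+

lemma list_emb_tail:
  assumes "list_emb P (x # xs) ys"
  shows "list_emb P xs ys"
proof -
  obtain us v vs where "ys = us @ v # vs" "list_emb P xs vs"
    using list_emb_ConsD[OF assms] by blast
  then show ?thesis
    by (simp add: list_emb_append2 list_emb_Cons)
qed

text \<open>Either \<open>x\<close> is matched with \<open>y\<close>, or all of
  \<open>x # xs\<close> already embeds into \<open>ys\<close>.\<close>

lemma list_emb_tails: "list_emb P (x # xs) (y # ys) \<Longrightarrow> list_emb P xs ys"
  by (erule list_emb.cases) (auto dest: list_emb_tail)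

lemma list_all2_imp_list_emb: "list_all2 P xs ys \<Longrightarrow> list_emb P xs ys"
  by (induction rule: list_all2_induct) auto

lemma queue_sim_imp_emb: "queue_sim G M M' \<Longrightarrow> queue_emb G M M'"
  by (simp add: queue_sim_def queue_emb_def list_all2_imp_list_emb)

lemma queue_emb_refl [simp]: "queue_emb G M M"
  by (simp add: queue_sim_imp_emb)

lemma queue_emb_msg_append: "queue_emb G M (\<langle>p, l, q\<rangle> \<cdot> M)"
  by (simp add: queue_emb_def channel_msg list_emb_Cons list_emb_refl)

lemma queue_emb_tail:
  assumes "queue_emb G (\<langle>p, l, q\<rangle> \<cdot> M) M'"
  shows "queue_emb G M M'"
  unfolding queue_emb_def
proof (intro allI)
  fix r s
  have "list_emb (label_sim G r s) (channel r s (\<langle>p, l, q\<rangle> \<cdot> M)) (channel r s M')"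
    using assms by (simp add: queue_emb_def)
  then show "list_emb (label_sim G r s) (channel r s M) (channel r s M')"
    by (auto simp: channel_msg split: if_splits dest: list_emb_tail)
qed

lemma queue_emb_tails:
  assumes "queue_emb G (\<langle>p, l, q\<rangle> \<cdot> M) (\<langle>p, l', q\<rangle> \<cdot> M')"
  shows "queue_emb G M M'"
  unfolding queue_emb_def
proof (intro allI)
  fix r s
  have "list_emb (label_sim G r s) (channel r s (\<langle>p, l, q\<rangle> \<cdot> M)) (channel r s (\<langle>p, l', q\<rangle> \<cdot> M'))"
    using assms by (simp add: queue_emb_def)
  then show "list_emb (label_sim G r s) (channel r s M) (channel r s M')"
    by (auto simp: channel_msg split: if_splits dest: list_emb_tails)
qed

lemma queue_emb_skip:
  assumes "queue_emb G M (\<langle>p, l', q\<rangle> \<cdot> M')"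
    and "\<And>l M''. M = \<langle>p, l, q\<rangle> \<cdot> M'' \<Longrightarrow> \<not> label_sim G p q l l'"
  shows "queue_emb G M M'"
  unfolding queue_emb_def
proof (intro allI)
  fix r s
  have *: "list_emb (label_sim G r s) (channel r s M) (channel r s (\<langle>p, l', q\<rangle> \<cdot> M'))"
    using assms(1) by (simp add: queue_emb_def)
  show "list_emb (label_sim G r s) (channel r s M) (channel r s M')"
  proof (cases "r = p \<and> s = q")
    case True
    show ?thesis
    proof (cases "channel r s M")
      case (Cons l ls)
      with True have "channel p q M = l # ls"
        by simp
      then have "\<not> label_sim G p q l l'"
        by (elim queue_head) (rule assms(2))
      then show ?thesis
        using * True Cons by (simp add: channel_msg)
    qed simp
  qed (use * in \<open>auto simp: channel_msg\<close>)
qed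

text \<open>Similar channels have equal length, so \<open>Q\<close> also has a first message on this
  channel, which can be pulled to the front.\<close>

lemma queue_sim_msg_appendE:
  assumes "queue_sim G Q (\<langle>p, l, q\<rangle> \<cdot> M)"
  obtains l' Q' where "Q = \<langle>p, l', q\<rangle> \<cdot> Q'" "label_sim G p q l' l" "queue_sim G Q' M"
proof -
  have "list_all2 (label_sim G p q) (channel p q Q) (channel p q (\<langle>p, l, q\<rangle> \<cdot> M))"
    using assms by (simp add: queue_sim_def)
  then obtain l' ls where "channel p q Q = l' # ls" and sim: "label_sim G p q l' l"
    by (auto simp: channel_msg list_all2_Cons2)
  then obtain Q' where Q: "Q = \<langle>p, l', q\<rangle> \<cdot> Q'"
    by (elim queue_head)
  have "list_all2 (label_sim G r s) (channel r s Q') (channel r s M)" for r s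
  proof -
    have "list_all2 (label_sim G r s) (channel r s Q) (channel r s (\<langle>p, l, q\<rangle> \<cdot> M))"
      using assms by (simp add: queue_sim_def)
    then show ?thesis
      by (simp add: Q channel_msg split: if_splits)
  qed
  then show thesis
    using that Q sim by (simp add: queue_sim_def)
qed

lemma queue_sim_empty: "queue_sim G Q \<emptyset> \<Longrightarrow> Q = \<emptyset>"
  by (simp add: queue_sim_def queue_eq_empty_iff)


section \<open>Readability\<close>

lemma queue_emb_empty:
  assumes "queue_emb G M \<emptyset>"
  shows "M = \<emptyset>"
  unfolding queue_eq_empty_iff
proof (intro allI)
  fix p q
  have "list_emb (label_sim G p q) (channel p q M) (channel p q \<emptyset>)"
    using assms unfolding queue_emb_def by blast
  then show "channel p q M = []"
    unfolding channel_empty by (rule list_emb_Nil2)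
qed

text \<open>By induction on readability of the larger queue. If \<open>M'\<close> offers a readable
  message, removing it, in case \<open>Inp\<close> together with the head \<open>h\<close> of the
  larger queue, preserves the embedding. If it offers none in case \<open>Inp\<close>, nothing is
  matched with \<open>h\<close>, which is skipped.\<close>

lemma read_queue_emb: "read G M \<Longrightarrow> queue_emb G M' M \<Longrightarrow> read G M'"
proof (induction arbitrary: M' rule: read.induct)
  case (empty G)
  then have "M' = \<emptyset>"
    by (blast dest: queue_emb_empty)
  then show ?case
    by (simp add: read.empty)
next
  case (Out B M p q)
  have "read G M'" if "fmlookup B l = Some G" for l G
    using Out.IH Out.prems that queue_emb_branch(1)[OF that] by blast
  then show ?case
    by (blast intro: read.Out)
next
  case (Inp h B M p q)
  have *: "read G K" if "fmlookup B l = Some G" "queue_emb (Inp p q B) K M" for l G K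
    using Inp.IH that queue_emb_branch(2)[OF that(1)] by blast
  show ?case
  proof (cases "\<exists>l K. l |\<in>| fmdom B \<and> M' = \<langle>p, l, q\<rangle> \<cdot> K")
    case True
    then obtain l K where l: "l |\<in>| fmdom B" and M': "M' = \<langle>p, l, q\<rangle> \<cdot> K"
      by blast
    have "queue_emb (Inp p q B) K M"
      using Inp.prems unfolding M' by (rule queue_emb_tails)
    then show ?thesis
      unfolding M' using l * by (blast intro: read.Inp)
  next
    case False
    have "queue_emb (Inp p q B) M' M"
      using Inp.prems
    proof (rule queue_emb_skip)
      fix l K
      assume "M' = \<langle>p, l, q\<rangle> \<cdot> K"
      with False have "l |\<notin>| fmdom B"
        by blast
      \<comment> \<open>Similar labels have equal lookups in \<open>B\<close>, but \<open>h\<close>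
        is in its domain and \<open>l\<close> is not.\<close>
      then show "\<not> label_sim (Inp p q B) p q l h"
        using Inp.hyps label_sim_Inp fmdom_notI fmdom_notD by metis
    qed
    with False * show ?thesis
      by (intro read.Inp_skip) blast+
  qed
next
  case (Inp_skip B M p q)
  have *: "read G K" if "fmlookup B l = Some G" "queue_emb (Inp p q B) K M" for l G K
    using Inp_skip.IH that queue_emb_branch(2)[OF that(1)] by blast
  show ?case
  proof (cases "\<exists>l K. l |\<in>| fmdom B \<and> M' = \<langle>p, l, q\<rangle> \<cdot> K")
    case True
    then obtain l K where l: "l |\<in>| fmdom B" and M': "M' = \<langle>p, l, q\<rangle> \<cdot> K"
      by blast
    have "queue_emb (Inp p q B) K M"
      using Inp_skip.prems unfolding M' by (rule queue_emb_tail)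
    then show ?thesis
      unfolding M' using l * by (blast intro: read.Inp)
  next
    case False
    with Inp_skip.prems * show ?thesis
      by (intro read.Inp_skip) blast+
  qed
qed

lemma read_queue_sim: "read G M \<Longrightarrow> queue_sim G M' M \<Longrightarrow> read G M'"
  by (blast intro: read_queue_emb queue_sim_imp_emb)

text \<open>Merges both input rules: if a message is readable, the branches must read the tail,
  which embeds into \<open>M\<close>.\<close>

lemma read_InpI:
  assumes "\<And>l G. fmlookup B l = Some G \<Longrightarrow> read G M"
  shows "read (Inp p q B) M"
proof (cases "\<exists>l K. l |\<in>| fmdom B \<and> M = \<langle>p, l, q\<rangle> \<cdot> K")
  case True
  then obtain h K where h: "h |\<in>| fmdom B" and M: "M = \<langle>p, h, q\<rangle> \<cdot> K"
    by blast
  have "read G K" if "fmlookup B l = Some G" for l G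
    using assms[OF that] queue_emb_msg_append unfolding M by (rule read_queue_emb)
  with h show ?thesis
    unfolding M by (blast intro: read.Inp)
next
  case False
  then show ?thesis
    using assms by (intro read.Inp_skip) blast+
qed

text \<open>The derivation-free content of \<open>dread\<close> with no hypotheses; unlike
  \<open>dread\<close>, it is visibly closed under subterms.\<close>

definition deep_read :: "('p, 'l) gtype \<Rightarrow> ('p, 'l) queue \<Rightarrow> bool" where
  "deep_read G M \<longleftrightarrow> (\<forall>G'. subterm G' G \<longrightarrow> read G' M)"

lemma deep_read_subterm: "deep_read G M \<Longrightarrow> subterm G' G \<Longrightarrow> deep_read G' M"
  unfolding deep_read_def using subterm_trans by blast

lemma deep_read_branch:
  assumes "fmlookup B l = Some G"
  shows "deep_read (Out p q B) M \<Longrightarrow> deep_read G M"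
    and "deep_read (Inp p q B) M \<Longrightarrow> deep_read G M"
  using assms by (blast intro: deep_read_subterm subterm.intros)+

text \<open>When \<open>M\<close> is used up, reading has arrived at some subterm, and deep
  readability provides for \<open>N\<close> there.\<close>

lemma read_append: "read G M \<Longrightarrow> deep_read G N \<Longrightarrow> read G (M \<cdot> N)"
proof (induction rule: read.induct)
  case (empty G)
  then show ?case
    by (simp add: deep_read_def subterm.refl)
next
  case (Out B M p q)
  then show ?case
    by (blast intro: read.Out deep_read_branch)
next
  case (Inp h B M p q)
  then show ?case
    by (simp add: queue_append_assoc) (blast intro: read.Inp deep_read_branch)
next
  case (Inp_skip B M p q)
  \<comment> \<open>An input that skips \<open>M\<close> may find its message in \<open>N\<close>;
    \<open>read_InpI\<close> covers both possibilities.\<close>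
  then show ?case
    by (blast intro: read_InpI deep_read_branch)
qed

lemma deep_read_append: "deep_read G M \<Longrightarrow> deep_read G N \<Longrightarrow> deep_read G (M \<cdot> N)"
  by (meson deep_read_def deep_read_subterm read_append)

lemma deep_read_queue_emb: "deep_read G M \<Longrightarrow> queue_emb G M' M \<Longrightarrow> deep_read G M'"
  by (meson deep_read_def queue_emb_subterm read_queue_emb)

lemma deep_read_End: "deep_read End M \<Longrightarrow> M = \<emptyset>"
  unfolding deep_read_def by (metis gtype.distinct(1,3) read.cases subterm.refl)

text \<open>The similarity says that the channel of \<open>N'\<close> is a rotation of that of \<open>N\<close>.\<close>

lemma rotation_emb:
  assumes "queue_sim G (N \<cdot> \<langle>p, l, q\<rangle>) (\<langle>p, l, q\<rangle> \<cdot> N')"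
  shows "queue_emb G N' (N \<cdot> N)"
  unfolding queue_emb_def
proof (intro allI)
  fix r s
  have *: "list_all2 (label_sim G r s) (channel r s (\<langle>p, l, q\<rangle> \<cdot> N')) (channel r s (N \<cdot> \<langle>p, l, q\<rangle>))"
    using queue_sim_sym[OF assms] by (simp add: queue_sim_def)
  show "list_emb (label_sim G r s) (channel r s N') (channel r s (N \<cdot> N))"
  proof (cases "r = p \<and> s = q")
    case True
    show ?thesis
    proof (cases "channel r s N")
      case Nil
      then show ?thesis
        using * True by (simp add: channel_msg)
    next
      case (Cons n ns)
      with * True have "label_sim G r s l n"
        and "list_all2 (label_sim G r s) (channel r s N') (ns @ [l])"
        by (auto simp: channel_msg)
      \<comment> \<open>The final \<open>l\<close> is replaced by the similar \<open>n\<close>,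
        because \<open>ns @ [n]\<close> is a contiguous part of
        \<open>(n # ns) @ (n # ns)\<close>.\<close>
      then have "list_all2 (label_sim G r s) (channel r s N') (ns @ [n])"
        by (auto simp: list_all2_append2 list_all2_Cons2 intro: label_sim_trans)
      then have "list_emb (label_sim G r s) (channel r s N') ((ns @ [n]) @ ns)"
        by (intro list_emb_prefix list_all2_imp_list_emb)
      then show ?thesis
        using Cons by (simp add: list_emb_Cons)
    qed
  next
    case False
    then have "list_all2 (label_sim G r s) (channel r s N') (channel r s N)"
      using * by (auto simp: channel_msg)
    then show ?thesis
      by (simp add: list_emb_prefix list_all2_imp_list_emb)
  qed
qed

lemma deep_read_rotation:
  assumes "deep_read G N" "queue_sim G (N \<cdot> \<langle>p, l, q\<rangle>) (\<langle>p, l, q\<rangle> \<cdot> N')"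
  shows "deep_read G N'"
  using assms by (blast intro: deep_read_queue_emb deep_read_append rotation_emb)


section \<open>Unfolding cyclic derivations\<close>

coinductive dread_unfold ::
    "('p, 'l) gtype set \<Rightarrow> ('p, 'l) queue \<Rightarrow> ('p, 'l) gtype \<Rightarrow> bool" for S M where
  End: "read End M \<Longrightarrow> dread_unfold S M End"
| hyp: "read G M \<Longrightarrow> G \<in> S \<Longrightarrow> dread_unfold S M G"
| Out: "read (Out p q B) M \<Longrightarrow> (\<forall>l G. fmlookup B l = Some G \<longrightarrow> dread_unfold S M G) \<Longrightarrow>
    dread_unfold S M (Out p q B)"
| Inp: "read (Inp p q B) M \<Longrightarrow> (\<forall>l G. fmlookup B l = Some G \<longrightarrow> dread_unfold S M G) \<Longrightarrow>
    dread_unfold S M (Inp p q B)"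

lemma dread_unfold_read: "dread_unfold S M G \<Longrightarrow> read G M"
  by (erule dread_unfold.cases) auto

text \<open>Discharges a hypothesis: each leaf citing \<open>Out p q B\<close> is continued with its
  branches again, and coinduction permits doing so forever.\<close>

lemma dread_unfold_Out:
  assumes "\<And>l G. fmlookup B l = Some G \<Longrightarrow> dread_unfold (insert (Out p q B) S) M G"
  shows "dread_unfold S M (Out p q B)"
proof -
  have "read (Out p q B) M"
    using assms by (blast intro: read.Out dread_unfold_read)
  moreover have "K = Out p q B \<or> dread_unfold (insert (Out p q B) S) M K \<Longrightarrow> dread_unfold S M K" for K
  proof (coinduction arbitrary: K)
    case (dread_unfold K)
    then show ?case
      using assms \<open>read (Out p q B) M\<close> by (auto elim: dread_unfold.cases)
  qed
  ultimately show ?thesis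
    by blast
qed

lemma dread_unfold_Inp:
  assumes "\<And>l G. fmlookup B l = Some G \<Longrightarrow> dread_unfold (insert (Inp p q B) S) M G"
  shows "dread_unfold S M (Inp p q B)"
proof -
  have "read (Inp p q B) M"
    using assms by (blast intro: read_InpI dread_unfold_read)
  moreover have "K = Inp p q B \<or> dread_unfold (insert (Inp p q B) S) M K \<Longrightarrow> dread_unfold S M K" for K
  proof (coinduction arbitrary: K)
    case (dread_unfold K)
    then show ?case
      using assms \<open>read (Inp p q B) M\<close> by (auto elim: dread_unfold.cases)
  qed
  ultimately show ?thesis
    by blast
qed

lemma dread_imp_unfold: "dread S G M \<Longrightarrow> dread_unfold (fset S) M G"
proof (induction rule: dread.induct)
  case (Out B p q S M)
  then show ?case
    by (intro dread_unfold_Out) auto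
next
  case (Inp B p q S M)
  then show ?case
    by (intro dread_unfold_Inp) auto
qed (auto intro: dread_unfold.intros read.empty)

text \<open>With no hypotheses left, the infinite derivation can be followed along any path to a
  subterm, and readability is recorded at each node.\<close>

lemma dread_imp_deep_read:
  assumes "dread {||} G M"
  shows "deep_read G M"
proof -
  have "subterm G' G \<Longrightarrow> dread_unfold {} M G \<Longrightarrow> read G' M" for G' G
  proof (induction rule: subterm.induct)
    case (refl G)
    then show ?case
      by (rule dread_unfold_read)
  next
    case (Out B l G' G p q)
    from Out.prems have "dread_unfold {} M G'"
      by cases (use Out.hyps in auto)
    then show ?case
      by (rule Out.IH)
  next
    case (Inp B l G' G p q)
    from Inp.prems have "dread_unfold {} M G'"
      by cases (use Inp.hyps in auto)
    then show ?case
      by (rule Inp.IH)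
  qed
  then show ?thesis
    using dread_imp_unfold[OF assms] by (simp add: deep_read_def)
qed

coinductive agr_unfold ::
    "(('p, 'l) gtype \<times> ('p, 'l) queue) set \<Rightarrow> ('p, 'l) gtype \<Rightarrow> ('p, 'l) queue \<Rightarrow> bool" for H where
  End: "agr_unfold H End M"
| hyp: "(G, M) \<in> H \<Longrightarrow> agr_unfold H G M"
| Out: "(\<forall>l G. fmlookup B l = Some G \<longrightarrow>
      (\<exists>M'. queue_sim G (M \<cdot> \<langle>p, l, q\<rangle>) (\<langle>p, l, q\<rangle> \<cdot> M') \<and> agr_unfold H G M')) \<Longrightarrow>
    agr_unfold H (Out p q B) M"
| Inp: "(\<forall>l G. fmlookup B l = Some G \<longrightarrow> agr_unfold H G M) \<Longrightarrow> agr_unfold H (Inp p q B) M"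

text \<open>The same grafting as in \<open>dread_unfold_Out\<close>, now at leaves citing the pair
  of type and queue.\<close>

lemma agr_unfold_Out:
  assumes "\<And>l G. fmlookup B l = Some G \<Longrightarrow> \<exists>M'. queue_sim G (M \<cdot> \<langle>p, l, q\<rangle>) (\<langle>p, l, q\<rangle> \<cdot> M') \<and>
    agr_unfold (insert (Out p q B, M) H) G M'"
  shows "agr_unfold H (Out p q B) M"
proof -
  have "(K, N) = (Out p q B, M) \<or> agr_unfold (insert (Out p q B, M) H) K N \<Longrightarrow> agr_unfold H K N"
    for K N
  proof (coinduction arbitrary: K N)
    case (agr_unfold K N)
    show ?case
    proof (cases "(K, N) = (Out p q B, M)")
      case True
      then show ?thesis
        using assms by fastforce
    next
      case False
      with agr_unfold have "agr_unfold (insert (Out p q B, M) H) K N"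
        by blast
      then show ?thesis
      proof cases
        case hyp
        then show ?thesis
          using False by auto
      next
        case (Out B' p' q')
        then show ?thesis
          by simp metis
      next
        case (Inp B' p' q')
        then show ?thesis
          by simp
      qed simp
    qed
  qed
  then show ?thesis
    by blast
qed

lemma agr_unfold_Inp:
  assumes "\<And>l G. fmlookup B l = Some G \<Longrightarrow> agr_unfold (insert (Inp p q B, M) H) G M"
  shows "agr_unfold H (Inp p q B) M"
proof -
  have "(K, N) = (Inp p q B, M) \<or> agr_unfold (insert (Inp p q B, M) H) K N \<Longrightarrow> agr_unfold H K N"
    for K N
  proof (coinduction arbitrary: K N)
    case (agr_unfold K N)
    show ?case
    proof (cases "(K, N) = (Inp p q B, M)")
      case True
      then show ?thesis
        using assms by fastforce
    next
      case False
      with agr_unfold have "agr_unfold (insert (Inp p q B, M) H) K N"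
        by blast
      then show ?thesis
      proof cases
        case hyp
        then show ?thesis
          using False by auto
      next
        case (Out B' p' q')
        then show ?thesis
          by simp metis
      next
        case (Inp B' p' q')
        then show ?thesis
          by simp
      qed simp
    qed
  qed
  then show ?thesis
    by blast
qed

lemma agr_imp_unfold: "agr H G M \<Longrightarrow> agr_unfold (fset H) G M"
proof (induction rule: agr.induct)
  case (Out B M p q H)
  then show ?case
    by (intro agr_unfold_Out) (fastforce dest: gequiv_imp_queue_sim)
next
  case (Inp B p q M H)
  then show ?case
    by (intro agr_unfold_Inp) auto
qed (auto intro: agr_unfold.intros)

lemma agr_unfold_branch:
  assumes "fmlookup B l = Some G"
  shows "agr_unfold {} (Out p q B) M \<Longrightarrow>
      \<exists>M'. queue_sim G (M \<cdot> \<langle>p, l, q\<rangle>) (\<langle>p, l, q\<rangle> \<cdot> M') \<and> agr_unfold {} G M'"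
    and "agr_unfold {} (Inp p q B) M \<Longrightarrow> agr_unfold {} G M"
  using assms by (auto elim: agr_unfold.cases)

text \<open>Provides the trivial surplus with which the replay of a derivation starts.\<close>

lemma agr_unfold_empty: "agr_unfold {} G \<emptyset>"
proof (coinduction arbitrary: G)
  case (agr_unfold G)
  then show ?case
    by (cases G) (auto intro!: exI[of _ \<emptyset>])
qed

text \<open>A new output moves first past \<open>N\<close> and then past \<open>M\<close>. This
  serves to join the surplus of a back edge to the one already carried.\<close>

lemma agr_unfold_append:
  assumes "agr_unfold {} G M" "agr_unfold {} G N"
  shows "agr_unfold {} G (M \<cdot> N)"
  using assms
proof (coinduction arbitrary: G M N)
  case (agr_unfold G M N)
  show ?case
  proof (cases G)
    case (Out p q B)
    have "\<exists>K. queue_sim G' ((M \<cdot> N) \<cdot> \<langle>p, l, q\<rangle>) (\<langle>p, l, q\<rangle> \<cdot> K) \<and>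
        (\<exists>M' N'. K = M' \<cdot> N' \<and> agr_unfold {} G' M' \<and> agr_unfold {} G' N')"
      if branch: "fmlookup B l = Some G'" for l G'
    proof -
      obtain M' N'
        where M': "queue_sim G' (M \<cdot> \<langle>p, l, q\<rangle>) (\<langle>p, l, q\<rangle> \<cdot> M')" "agr_unfold {} G' M'"
          and N': "queue_sim G' (N \<cdot> \<langle>p, l, q\<rangle>) (\<langle>p, l, q\<rangle> \<cdot> N')" "agr_unfold {} G' N'"
        using agr_unfold agr_unfold_branch(1)[OF branch] unfolding Out by meson
      have "queue_sim G' (M \<cdot> (N \<cdot> \<langle>p, l, q\<rangle>)) (M \<cdot> (\<langle>p, l, q\<rangle> \<cdot> N'))"
        using N' by (simp add: queue_sim_append)
      moreover have "queue_sim G' ((M \<cdot> \<langle>p, l, q\<rangle>) \<cdot> N') ((\<langle>p, l, q\<rangle> \<cdot> M') \<cdot> N')"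
        using M' by (simp add: queue_sim_append)
      ultimately have "queue_sim G' ((M \<cdot> N) \<cdot> \<langle>p, l, q\<rangle>) (\<langle>p, l, q\<rangle> \<cdot> M' \<cdot> N')"
        unfolding queue_append_assoc by (rule queue_sim_trans)
      with M' N' show ?thesis
        by blast
    qed
    then show ?thesis
      unfolding Out by simp metis
  next
    case (Inp p q B)
    have "agr_unfold {} G' M \<and> agr_unfold {} G' N" if "fmlookup B l = Some G'" for l G'
      using agr_unfold agr_unfold_branch(2)[OF that] unfolding Inp by blast
    then show ?thesis
      unfolding Inp by simp metis
  qed simp
qed

section \<open>Derivations of inductive balancing as graphs\<close>

inductive ib_step ::
    "(('p, 'l) gtype \<Rightarrow> ('p, 'l) queue \<Rightarrow> bool) \<Rightarrow> ('p, 'l) gtype \<Rightarrow> ('p, 'l) queue \<Rightarrow> bool" for P where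
  Out: "read (Out p q B) M \<Longrightarrow>
    (\<forall>l G. fmlookup B l = Some G \<longrightarrow> P G (M \<cdot> \<langle>p, l, q\<rangle>)) \<Longrightarrow> ib_step P (Out p q B) M"
| Inp: "fmlookup B h = Some G \<Longrightarrow> read (Inp p q B) (\<langle>p, h, q\<rangle> \<cdot> M) \<Longrightarrow> P G M \<Longrightarrow>
    ib_step P (Inp p q B) (\<langle>p, h, q\<rangle> \<cdot> M)"

lemma ib_step_mono:
  assumes "ib_step P G M" "\<And>G M. P G M \<Longrightarrow> Q G M"
  shows "ib_step Q G M"
  using assms by (fastforce elim: ib_step.cases intro: ib_step.intros)

text \<open>\<open>X\<close> stands for the inner nodes of a derivation. Back edges are required to lead to inner nodes
  (or to hypotheses), so that following one is always succeeded by a proper step.\<close>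

inductive ib_node ::
    "(('p, 'l) gtype \<times> ('p, 'l) queue) set \<Rightarrow> (('p, 'l) gtype \<times> ('p, 'l) queue) set \<Rightarrow>
     ('p, 'l) gtype \<Rightarrow> ('p, 'l) queue \<Rightarrow> bool" for H X where
  End: "ib_node H X End \<emptyset>"
| inner: "(G, M) \<in> X \<Longrightarrow> ib_node H X G M"
| loop: "(G, M) \<in> H \<union> X \<Longrightarrow> ok G M M' \<Longrightarrow> ib_node H X G M'"

definition ib_closed ::
    "(('p, 'l) gtype \<times> ('p, 'l) queue) set \<Rightarrow> (('p, 'l) gtype \<times> ('p, 'l) queue) set \<Rightarrow> bool" where
  "ib_closed H X \<longleftrightarrow> (\<forall>(G, M)\<in>X. ib_step (ib_node H X) G M)"

lemma ib_node_mono: "ib_node H X G M \<Longrightarrow> H \<union> X \<subseteq> H' \<union> X' \<Longrightarrow> X \<subseteq> X' \<Longrightarrow> ib_node H' X' G M"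
  by (induction rule: ib_node.induct) (auto intro: ib_node.intros)

lemma ib_close:
  assumes "ib_step (\<lambda>G M. \<exists>X. ib_closed (insert (G\<^sub>0, M\<^sub>0) H) X \<and> ib_node (insert (G\<^sub>0, M\<^sub>0) H) X G M) G\<^sub>0 M\<^sub>0"
  shows "\<exists>X. ib_closed H X \<and> (G\<^sub>0, M\<^sub>0) \<in> X"
proof -
  \<comment> \<open>The union of all closed sets avoids choosing one for each branch.\<close>
  define X where "X = insert (G\<^sub>0, M\<^sub>0) (\<Union>{X. ib_closed (insert (G\<^sub>0, M\<^sub>0) H) X})"
  \<comment> \<open>The pair \<open>(G\<^sub>0, M\<^sub>0)\<close> moves from the hypotheses to the
    inner nodes, so back edges to it remain valid.\<close>
  have node: "ib_node H X G M"
    if "ib_node (insert (G\<^sub>0, M\<^sub>0) H) Y G M" "ib_closed (insert (G\<^sub>0, M\<^sub>0) H) Y" for Y G M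
    using that(1) by (rule ib_node_mono) (use that(2) in \<open>auto simp: X_def\<close>)
  have "ib_step (ib_node H X) G M" if mem: "(G, M) \<in> X" for G M
  proof (cases "(G, M) = (G\<^sub>0, M\<^sub>0)")
    case True
    then show ?thesis
      using assms node by (auto elim!: ib_step_mono)
  next
    case False
    then obtain Y where Y: "ib_closed (insert (G\<^sub>0, M\<^sub>0) H) Y" "(G, M) \<in> Y"
      using mem unfolding X_def by blast
    then have "ib_step (ib_node (insert (G\<^sub>0, M\<^sub>0) H) Y) G M"
      by (auto simp: ib_closed_def)
    then show ?thesis
      using node[OF _ Y(1)] by (rule ib_step_mono)
  qed
  then have "ib_closed H X"
    by (auto simp: ib_closed_def)
  then show ?thesis
    by (auto simp: X_def)
qed

text \<open>At \<open>Out\<close> and \<open>Inp\<close>, \<open>ib_close\<close> turns the pair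
  assumed by the premises into an inner node.\<close>

lemma ibalanced_nodes: "ibalanced H G M \<Longrightarrow> \<exists>X. ib_closed (fset H) X \<and> ib_node (fset H) X G M"
proof (induction rule: ibalanced.induct)
  case (End H)
  have "ib_closed (fset H) {}"
    by (simp add: ib_closed_def)
  then show ?case
    by (blast intro: ib_node.End)
next
  case (cycle G M M' H)
  have "ib_closed (fset (finsert (G, M) H)) {}"
    by (simp add: ib_closed_def)
  moreover have "ib_node (fset (finsert (G, M) H)) {} G M'"
    using cycle by (auto intro: ib_node.loop)
  ultimately show ?case
    by blast
next
  case (Out p q B M H)
  have "\<exists>X. ib_closed (fset H) X \<and> (Out p q B, M) \<in> X"
    by (rule ib_close, rule ib_step.Out) (use Out in auto)
  then show ?case
    by (blast intro: ib_node.inner)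
next
  case (Inp B h G p q M H)
  have "\<exists>X. ib_closed (fset H) X \<and> (Inp p q B, \<langle>p, h, q\<rangle> \<cdot> M) \<in> X"
    by (rule ib_close, rule ib_step.Inp) (use Inp in auto)
  then show ?case
    by (blast intro: ib_node.inner)
qed


section \<open>Soundness of inductive balancing\<close>

text \<open>\<open>Q\<close> is the actual queue and \<open>M\<close> the queue at the corresponding node of the derivation.\<close>

inductive surplus :: "('p, 'l) gtype \<Rightarrow> ('p, 'l) queue \<Rightarrow> ('p, 'l) queue \<Rightarrow> bool" for G M Q where
  "agr_unfold {} G N \<Longrightarrow> deep_read G N \<Longrightarrow> queue_sim G Q (M \<cdot> N) \<Longrightarrow> surplus G M Q"

lemma surplus_refl: "surplus G M M"
  using agr_unfold_empty by (rule surplus.intros) (simp_all add: deep_read_def read.empty)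

text \<open>Follows a back edge from \<open>M\<close> to \<open>M\<^sub>0\<close>: its surplus
  \<open>N\<close> is put in front of the surplus \<open>K\<close> carried so far.\<close>

lemma surplus_ok:
  assumes "ok G M\<^sub>0 M" "surplus G M Q"
  shows "surplus G M\<^sub>0 Q"
proof -
  from assms(1) obtain N where M: "M = M\<^sub>0 \<cdot> N"
    and N: "agr_unfold {} G N" "deep_read G N"
    using agr_imp_unfold[of "{||}" G] dread_imp_deep_read[of G] by (auto simp: ok_def)
  from assms(2) obtain K where K: "agr_unfold {} G K" "deep_read G K" "queue_sim G Q (M \<cdot> K)"
    by (auto elim: surplus.cases)
  show ?thesis
  proof
    show "agr_unfold {} G (N \<cdot> K)"
      using N K by (blast intro: agr_unfold_append)
    show "deep_read G (N \<cdot> K)"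
      using N K by (blast intro: deep_read_append)
    show "queue_sim G Q (M\<^sub>0 \<cdot> N \<cdot> K)"
      using K(3) by (simp add: M queue_append_assoc)
  qed
qed

lemma surplus_read: "read G M \<Longrightarrow> surplus G M Q \<Longrightarrow> read G Q"
  by (auto elim!: surplus.cases intro: read_queue_sim read_append)

lemma surplus_End: "surplus End \<emptyset> Q \<Longrightarrow> Q = \<emptyset>"
  by (auto elim!: surplus.cases dest!: deep_read_End intro: queue_sim_empty)

text \<open>The output lands behind the surplus in the actual queue but in front of it in the
  derivation. Agreement exchanges the two, turning \<open>N\<close> into \<open>N'\<close>, which is
  deeply readable by rotation.\<close>

lemma surplus_Out:
  assumes "surplus (Out p q B) M Q" "fmlookup B l = Some G"
  shows "surplus G (M \<cdot> \<langle>p, l, q\<rangle>) (Q \<cdot> \<langle>p, l, q\<rangle>)"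
proof -
  from assms(1) obtain N where N: "agr_unfold {} (Out p q B) N" "deep_read (Out p q B) N"
    and Q: "queue_sim (Out p q B) Q (M \<cdot> N)"
    by (auto elim: surplus.cases)
  obtain N' where N': "queue_sim G (N \<cdot> \<langle>p, l, q\<rangle>) (\<langle>p, l, q\<rangle> \<cdot> N')" "agr_unfold {} G N'"
    using agr_unfold_branch(1)[OF assms(2) N(1)] by blast
  show ?thesis
  proof
    show "agr_unfold {} G N'"
      by fact
    show "deep_read G N'"
      using deep_read_branch(1)[OF assms(2) N(2)] N'(1) by (rule deep_read_rotation)
    have "queue_sim G Q (M \<cdot> N)"
      using Q by (rule queue_sim_subterm) (blast intro: assms subterm.intros)
    then have "queue_sim G (Q \<cdot> \<langle>p, l, q\<rangle>) (M \<cdot> (N \<cdot> \<langle>p, l, q\<rangle>))"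
      using queue_sim_append[OF _ queue_sim_refl] by (metis queue_append_assoc)
    moreover have "queue_sim G (M \<cdot> (N \<cdot> \<langle>p, l, q\<rangle>)) (M \<cdot> (\<langle>p, l, q\<rangle> \<cdot> N'))"
      using N'(1) by (simp add: queue_sim_append)
    ultimately show "queue_sim G (Q \<cdot> \<langle>p, l, q\<rangle>) ((M \<cdot> \<langle>p, l, q\<rangle>) \<cdot> N')"
      unfolding queue_append_assoc by (rule queue_sim_trans)
  qed
qed

text \<open>The label \<open>h'\<close> actually read may differ from \<open>h\<close>, but
  similarity makes both select the same branch.\<close>

lemma surplus_Inp:
  assumes "surplus (Inp p q B) (\<langle>p, h, q\<rangle> \<cdot> M) Q" "fmlookup B h = Some G"
  obtains h' Q' where "Q = \<langle>p, h', q\<rangle> \<cdot> Q'" "fmlookup B h' = Some G" "surplus G M Q'"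
proof -
  from assms(1) obtain N where N: "agr_unfold {} (Inp p q B) N" "deep_read (Inp p q B) N"
    and "queue_sim (Inp p q B) Q (\<langle>p, h, q\<rangle> \<cdot> M \<cdot> N)"
    by (auto elim: surplus.cases simp: queue_append_assoc)
  then obtain h' Q' where Q: "Q = \<langle>p, h', q\<rangle> \<cdot> Q'"
    and h': "label_sim (Inp p q B) p q h' h" and Q': "queue_sim (Inp p q B) Q' (M \<cdot> N)"
    by (elim queue_sim_msg_appendE)
  have "surplus G M Q'"
  proof
    show "agr_unfold {} G N"
      using agr_unfold_branch(2)[OF assms(2) N(1)] .
    show "deep_read G N"
      using deep_read_branch(2)[OF assms(2) N(2)] .
    show "queue_sim G Q' (M \<cdot> N)"
      using Q' by (rule queue_sim_subterm) (blast intro: assms subterm.intros)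
  qed
  then show thesis
    using that Q h' assms(2) by (metis label_sim_Inp)
qed

theorem theorem6p8:
  fixes G :: "('p, 'l) gtype" and M :: "('p, 'l) queue"
  assumes "global_type G"
    and "ibalanced {||} G M"
  shows "balanced G M"
proof -
  obtain X where closed: "ib_closed {} X" and node: "ib_node {} X G M"
    using ibalanced_nodes[OF assms(2)] by auto
  have "ib_node {} X G M \<Longrightarrow> surplus G M Q \<Longrightarrow> balanced G Q" for G M Q
  proof (coinduction arbitrary: G M Q)
    case (balanced G M Q)
    \<comment> \<open>Coinduction requires a proper step, which closedness supplies at inner nodes.
      The queue is generalized so that this also applies to the target of a back edge.\<close>
    have progress: "?case" if mem: "(G, M) \<in> X" and surplus: "surplus G M Q" for M
    proof -
      from closed mem have "ib_step (ib_node {} X) G M"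
        by (auto simp: ib_closed_def)
      then show ?thesis
      proof cases
        case (Out p q B)
        have "read G Q"
          using Out surplus by (blast intro: surplus_read)
        moreover have "ib_node {} X G' (M \<cdot> \<langle>p, l, q\<rangle>) \<and> surplus G' (M \<cdot> \<langle>p, l, q\<rangle>) (Q \<cdot> \<langle>p, l, q\<rangle>)"
          if "fmlookup B l = Some G'" for l G'
          using Out that surplus_Out[OF _ that] surplus by simp
        ultimately show ?thesis
          using Out by simp metis
      next
        case (Inp B h G' p q M')
        have "read G Q"
          using Inp surplus by (blast intro: surplus_read)
        from surplus have "surplus (Inp p q B) (\<langle>p, h, q\<rangle> \<cdot> M') Q"
          using Inp by simp
        then obtain h' Q' where "Q = \<langle>p, h', q\<rangle> \<cdot> Q'" "fmlookup B h' = Some G'" "surplus G' M' Q'"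
          using Inp(3) by (rule surplus_Inp)
        with \<open>read G Q\<close> Inp show ?thesis
          by blast
      qed
    qed
    from balanced(1) show ?case
    proof cases
      case End
      then show ?thesis
        using balanced(2) surplus_End by blast
    next
      case inner
      then show ?thesis
        using balanced(2) by (rule progress)
    next
      \<comment> \<open>With no hypotheses the target lies in \<open>X\<close>, so a single jump
        reaches an inner node.\<close>
      case (loop M\<^sub>0)
      then show ?thesis
        using balanced(2) by (intro progress[of M\<^sub>0]) (auto intro: surplus_ok)
    qed
  qed
  then show ?thesis
    using node surplus_refl by blast
qed

end
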